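(* Suppose that Assumptions (S), (G), (LC) and (R) stated in the context hold, and let $\{x^k\}_{k\ge 1}$ be the sequence of iterates generated by the inexact power augmented Lagrangian method described in the context. Suppose there exists a nonempty compact set $\mathcal S\subseteq \operatorname{dom} g$ containing the iterates $\{x^k\}_{k\ge1}$, and let $\nabla f_{\max}, J_{A\max}, G, R$ be the constants given by Assumptions (S), (G), (R) for this set $\mathcal S$. Let $y_{\max}$ be a bound with $\|y^k\|\le y_{\max}$ for all $k\ge 1$. Define $$Q_f := \lambda + J_{A\max}\,\sigma_1\,\frac{\nabla f_{\max}+G+J_{A\max}\,y_{\max}+\varepsilon_1}{R},\qquad Q_A := \left(\frac{\nabla f_{\max}+G+J_{A\max}\,y_{\max}+\varepsilon_1}{R}\right)^{1/\nu}.$$ Then, for every $k\ge 1$, $x^{k+1}$ is a $$\left(\frac{Q_f}{\beta_1\omega^{k-1}},\ \frac{Q_A}{\beta_1^{1/\nu}\,\omega^{(k-1)/\nu}}\right)\text{-stationary point}$$ of the problem $\min_{x\in\mathbb R^n} f(x)+g(x)$ s.t. $A(x)=0$.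
   Context: Problem: minimize $\varphi(x):=f(x)+g(x)$ over $x\in\mathbb R^n$ subject to $A(x)=0$, where $f:\mathbb R^n\to\mathbb R$ is continuously differentiable (possibly nonconvex), $g:\mathbb R^n\to\mathbb R\cup\{+\infty\}$ is proper, lsc and convex, and $A:\mathbb R^n\to\mathbb R^m$ is continuously differentiable with Jacobian $J_A(x)\in\mathbb R^{m\times n}$. Norms are Euclidean for vectors and spectral for matrices; $\operatorname{dist}(x,\mathcal C)$ is the Euclidean distance; $\partial g$ is the convex subdifferential; $N_{\mathcal X}(x)$ is the normal cone of convex analysis. Stationarity: $x$ is an $(\varepsilon_\varphi,\varepsilon_A)$-stationary point if there is $y\in\mathbb R^m$ with $\|A(x)\|\le\varepsilon_A$ and $\operatorname{dist}(-\nabla f(x)-J_A^\top(x)y,\partial g(x))\le\varepsilon_\varphi$. Fix $\nu\in(0,1]$ and $\phi(z)=\frac1{\nu+1}\|z\|^{\nu+1}$, so $\nabla\phi(z)=\|z\|^{\nu-1}z$ for $z\ne0$ and $\nabla\phi(0)=0$. For $\beta>0$ let $\psi_\beta(x,y):=f(x)+\langle A(x),y\rangle+\frac{\beta}{\nu+1}\|A(x)\|^{\nu+1}$ and $L_\beta(x,y):=\psi_\beta(x,y)+g(x)$. Inexact power augmented Lagrangian method: given $x^1\in\mathbb R^n$, $y^1\in\mathbb R^m$, $\lambda>0$, $\omega>1$, $\sigma_1>0$, $\beta_1>0$, $\nu\in(0,1]$, for $k=1,2,\dots$: (1) set $\varepsilon_{k+1}=\lambda/\beta_k$ and obtain $x^{k+1}\in\mathbb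 R^n$ with $\operatorname{dist}(-\nabla_x\psi_{\beta_k}(x^{k+1},y^k),\partial g(x^{k+1}))\le\varepsilon_{k+1}$; (2) set $\sigma_{k+1}=\sigma_1\min\left(1,\frac{\|A(x^1)\|^\nu\log^2(2)}{\|A(x^{k+1})\|^\nu(k+1)\log^2(k+2)}\right)$ (the minimum is read as $1$ if $A(x^{k+1})=0$); (3) set $y^{k+1}=y^k+\sigma_{k+1}\nabla\phi(A(x^{k+1}))$; (4) set $\beta_{k+1}=\omega\beta_k$. The multiplier sequence $\{y^k\}$ generated this way is bounded, so a $y_{\max}$ exists. $\varepsilon_1$ denotes any number with $\varepsilon_1\ge\varepsilon_2=\lambda/\beta_1$. Assumption (S): for any nonempty compact $\mathcal S\subseteq\operatorname{dom}g$ there exist positive constants $H_f,H_A,A_{\max},J_{A\max},\nabla f_{\max}$ and exponents $\nu_f,\nu_A\in(0,1]$ such that $\|\nabla f(x')-\nabla f(x)\|\le H_f\|x'-x\|^{\nu_f}$ and $\|J_A(x')-J_A(x)\|\le H_A\|x'-x\|^{\nu_A}$ for all $x,x'\in\mathcal S$, and $\|\nabla f(x)\|\le\nabla f_{\max}$, $\|A(x)\|\le A_{\max}$, $\|J_A(x)\|\le J_{A\max}$ for all $x\in\mathcal S$. Assumption (G): $g$ is proper, lsc and convex, $\operatorname{dom}g$ has nonempty interior, and for any nonempty compact $\mathcal S\subseteq\operatorname{dom}g$ there is $G\ge0$ with $|g(x')-g(x)|\le G\|x'-x\|$ for all $x,x'\in\mathcal S$. Assumption (LC): $\varphi=f+g$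 is level-coercive, i.e. bounded below on bounded sets and $\liminf_{\|x\|\to\infty}\varphi(x)/\|x\|>0$. Assumption (R): for any nonempty compact $\mathcal S\subseteq\operatorname{dom}g$ there is $R>0$ such that $\operatorname{dist}(-J_A^\top(x)A(x),N_{\operatorname{dom}g}(x))\ge R\|A(x)\|$ for all $x\in\mathcal S$.
   Formalization: G is a Lipschitz constant of g on the intersection of dom g with a neighbourhood of S, not merely on S (with an arbitrary Lipschitz constant on S the claim is false); such a G is proved to exist under (G), and the bounds hold for every such G. *)

theory Defs
  imports "HOL-Analysis.Analysis"
begin

section \<open>Convex analysis for extended-real-valued functions\<close>

definition effdom :: "('a \<Rightarrow> ereal) \<Rightarrow> 'a set"
  where "effdom g = {x. g x < \<infinity>}"

definition proper :: "('a \<Rightarrow> ereal) \<Rightarrow> bool"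
  where "proper g \<longleftrightarrow> (\<forall>x. g x \<noteq> -\<infinity>) \<and> effdom g \<noteq> {}"

definition lsc :: "('a::topological_space \<Rightarrow> ereal) \<Rightarrow> bool"
  where "lsc g \<longleftrightarrow> (\<forall>x. g x \<le> Liminf (at x) g)"

definition convex_ereal :: "('a::real_vector \<Rightarrow> ereal) \<Rightarrow> bool"
  where "convex_ereal g \<longleftrightarrow>
    (\<forall>x y. \<forall>t\<in>{0<..<1}. g ((1 - t) *\<^sub>R x + t *\<^sub>R y) \<le> ereal (1 - t) * g x + ereal t * g y)"

definition subdifferential :: "('a::real_inner \<Rightarrow> ereal) \<Rightarrow> 'a \<Rightarrow> 'a set"
  where "subdifferential g x = {v. \<forall>z. g x + ereal (v \<bullet> (z - x)) \<le> g z}"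

definition normal_cone :: "'a::real_inner set \<Rightarrow> 'a \<Rightarrow> 'a set"
  where "normal_cone X x = (if x \<in> X then {v. \<forall>z\<in>X. v \<bullet> (z - x) \<le> 0} else {})"

text \<open>Unlike \<^const>\<open>infdist\<close>, which is 0 on the empty set, this distance is infinite there; a
  real upper bound on the distance to a subdifferential therefore forces it to be nonempty.\<close>

definition set_dist :: "'a::metric_space \<Rightarrow> 'a set \<Rightarrow> ereal"
  where "set_dist p C = (INF q\<in>C. ereal (dist p q))"


section \<open>Derivatives and the spectral norm\<close>

definition grad :: "('a::real_inner \<Rightarrow> real) \<Rightarrow> 'a \<Rightarrow> 'a"
  where "grad F x = (THE D. GDERIV F x :> D)"

definition Jac :: "(real^'n \<Rightarrow> real^'m) \<Rightarrow> real^'n \<Rightarrow> real^'n^'m"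
  where "Jac A x = jacobian A (at x)"

text \<open>The library norm on matrices is the Frobenius norm.\<close>

definition spec_norm :: "real^'n^'m \<Rightarrow> real"
  where "spec_norm M = onorm (\<lambda>v. M *v v)"

definition C1_fun :: "('a::real_inner \<Rightarrow> real) \<Rightarrow> bool"
  where "C1_fun f \<longleftrightarrow> (\<forall>x. f differentiable (at x)) \<and> continuous_on UNIV (grad f)"

definition C1_map :: "(real^'n \<Rightarrow> real^'m) \<Rightarrow> bool"
  where "C1_map A \<longleftrightarrow> (\<forall>x. A differentiable (at x)) \<and> continuous_on UNIV (Jac A)"


section \<open>Stationarity and the power augmented Lagrangian\<close>

definition stationary_point ::
    "(real^'n \<Rightarrow> real) \<Rightarrow> (real^'n \<Rightarrow> ereal) \<Rightarrow> (real^'n \<Rightarrow> real^'m) \<Rightarrow> real \<Rightarrow> real \<Rightarrow> real^'n \<Rightarrow> bool"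
  where "stationary_point f g A \<epsilon>\<phi> \<epsilon>A x \<longleftrightarrow>
    (\<exists>y. norm (A x) \<le> \<epsilon>A \<and>
         set_dist (- grad f x - transpose (Jac A x) *v y) (subdifferential g x) \<le> ereal \<epsilon>\<phi>)"

definition pow_fun :: "real \<Rightarrow> 'a::real_inner \<Rightarrow> real"
  where "pow_fun \<nu> z = 1 / (\<nu> + 1) * norm z powr (\<nu> + 1)"

definition psi :: "(real^'n \<Rightarrow> real) \<Rightarrow> (real^'n \<Rightarrow> real^'m) \<Rightarrow> real \<Rightarrow> real \<Rightarrow> real^'n \<Rightarrow> real^'m \<Rightarrow> real"
  where "psi f A \<nu> \<beta> x y = f x + A x \<bullet> y + \<beta> * pow_fun \<nu> (A x)"

text \<open>Sequences are indexed from 1; their values at 0 are irrelevant. The value \<open>\<epsilon> 1\<close>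
  is not constrained here.\<close>

definition inexact_power_ALM ::
    "(real^'n \<Rightarrow> real) \<Rightarrow> (real^'n \<Rightarrow> ereal) \<Rightarrow> (real^'n \<Rightarrow> real^'m) \<Rightarrow> real \<Rightarrow> real \<Rightarrow> real \<Rightarrow>
     (nat \<Rightarrow> real) \<Rightarrow> (nat \<Rightarrow> real) \<Rightarrow> (nat \<Rightarrow> real) \<Rightarrow> (nat \<Rightarrow> real^'n) \<Rightarrow> (nat \<Rightarrow> real^'m) \<Rightarrow> bool"
  where "inexact_power_ALM f g A \<nu> lam \<omega> \<sigma> \<beta> \<epsilon> x y \<longleftrightarrow>
    0 < \<nu> \<and> \<nu> \<le> 1 \<and> lam > 0 \<and> \<omega> > 1 \<and> \<sigma> 1 > 0 \<and> \<beta> 1 > 0 \<and>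
    (\<forall>k\<ge>1.
       \<epsilon> (k + 1) = lam / \<beta> k \<and>
       set_dist (- grad (\<lambda>z. psi f A \<nu> (\<beta> k) z (y k)) (x (k + 1)))
                (subdifferential g (x (k + 1))) \<le> ereal (\<epsilon> (k + 1)) \<and>
       \<sigma> (k + 1) = (if A (x (k + 1)) = 0 then \<sigma> 1 else
          \<sigma> 1 * min 1 (norm (A (x 1)) powr \<nu> * (ln 2)\<^sup>2 /
             (norm (A (x (k + 1))) powr \<nu> * real (k + 1) * (ln (real (k + 2)))\<^sup>2))) \<and>
       y (k + 1) = y k + \<sigma> (k + 1) *\<^sub>R grad (pow_fun \<nu>) (A (x (k + 1))) \<and>
       \<beta> (k + 1) = \<omega> * \<beta> k)"


section \<open>Assumptions\<close>

definition S_constants ::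
    "(real^'n \<Rightarrow> real) \<Rightarrow> (real^'n \<Rightarrow> real^'m) \<Rightarrow> (real^'n) set \<Rightarrow>
     real \<Rightarrow> real \<Rightarrow> real \<Rightarrow> real \<Rightarrow> real \<Rightarrow> real \<Rightarrow> real \<Rightarrow> bool"
  where "S_constants f A S H\<^sub>f H\<^sub>A Amax Jmax Fmax \<nu>\<^sub>f \<nu>\<^sub>A \<longleftrightarrow>
    H\<^sub>f > 0 \<and> H\<^sub>A > 0 \<and> Amax > 0 \<and> Jmax > 0 \<and> Fmax > 0 \<and>
    0 < \<nu>\<^sub>f \<and> \<nu>\<^sub>f \<le> 1 \<and> 0 < \<nu>\<^sub>A \<and> \<nu>\<^sub>A \<le> 1 \<and>
    (\<forall>x\<in>S. \<forall>x'\<in>S.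
       norm (grad f x' - grad f x) \<le> H\<^sub>f * norm (x' - x) powr \<nu>\<^sub>f \<and>
       spec_norm (Jac A x' - Jac A x) \<le> H\<^sub>A * norm (x' - x) powr \<nu>\<^sub>A) \<and>
    (\<forall>x\<in>S. norm (grad f x) \<le> Fmax \<and> norm (A x) \<le> Amax \<and> spec_norm (Jac A x) \<le> Jmax)"

definition assumption_S ::
    "(real^'n \<Rightarrow> real) \<Rightarrow> (real^'n \<Rightarrow> ereal) \<Rightarrow> (real^'n \<Rightarrow> real^'m) \<Rightarrow> bool"
  where "assumption_S f g A \<longleftrightarrow>
    (\<forall>S. S \<noteq> {} \<and> compact S \<and> S \<subseteq> effdom g \<longrightarrow>
       (\<exists>H\<^sub>f H\<^sub>A Amax Jmax Fmax \<nu>\<^sub>f \<nu>\<^sub>A. S_constants f A S H\<^sub>f H\<^sub>A Amax Jmax Fmax \<nu>\<^sub>f \<nu>\<^sub>A))"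

definition G_constant :: "('a::real_normed_vector \<Rightarrow> ereal) \<Rightarrow> 'a set \<Rightarrow> real \<Rightarrow> bool"
  where "G_constant g S G \<longleftrightarrow>
    G \<ge> 0 \<and> (\<forall>x\<in>S. \<forall>x'\<in>S. \<bar>g x' - g x\<bar> \<le> ereal (G * norm (x' - x)))"

definition assumption_G :: "('a::real_normed_vector \<Rightarrow> ereal) \<Rightarrow> bool"
  where "assumption_G g \<longleftrightarrow>
    proper g \<and> lsc g \<and> convex_ereal g \<and> interior (effdom g) \<noteq> {} \<and>
    (\<forall>S. S \<noteq> {} \<and> compact S \<and> S \<subseteq> effdom g \<longrightarrow> (\<exists>G. G_constant g S G))"

text \<open>A Lipschitz constant of \<open>g\<close> on \<open>S\<close> alone does not control the subgradients at points of
  \<open>S\<close> (for \<open>S\<close> a singleton, \<open>G = 0\<close> is always such a constant). The constant that enters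
  the complexity bounds has to be one on a neighbourhood of \<open>S\<close> relative to the domain of \<open>g\<close>.\<close>

definition G_constant_near :: "('a::real_normed_vector \<Rightarrow> ereal) \<Rightarrow> 'a set \<Rightarrow> real \<Rightarrow> bool"
  where "G_constant_near g S G \<longleftrightarrow> (\<exists>U. open U \<and> S \<subseteq> U \<and> G_constant g (U \<inter> effdom g) G)"

definition assumption_LC :: "('a::real_normed_vector \<Rightarrow> real) \<Rightarrow> ('a \<Rightarrow> ereal) \<Rightarrow> bool"
  where "assumption_LC f g \<longleftrightarrow>
    (\<forall>B. bounded B \<longrightarrow> (\<exists>c::real. \<forall>x\<in>B. ereal c \<le> ereal (f x) + g x)) \<and>
    Liminf at_infinity (\<lambda>x. (ereal (f x) + g x) / ereal (norm x)) > 0"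

definition R_constant ::
    "(real^'n \<Rightarrow> ereal) \<Rightarrow> (real^'n \<Rightarrow> real^'m) \<Rightarrow> (real^'n) set \<Rightarrow> real \<Rightarrow> bool"
  where "R_constant g A S R \<longleftrightarrow>
    R > 0 \<and> (\<forall>x\<in>S. set_dist (- (transpose (Jac A x) *v A x)) (normal_cone (effdom g) x)
                    \<ge> ereal (R * norm (A x)))"

definition assumption_R :: "(real^'n \<Rightarrow> ereal) \<Rightarrow> (real^'n \<Rightarrow> real^'m) \<Rightarrow> bool"
  where "assumption_R g A \<longleftrightarrow>
    (\<forall>S. S \<noteq> {} \<and> compact S \<and> S \<subseteq> effdom g \<longrightarrow> (\<exists>R. R_constant g A S R))"

end

theory Submission
  imports Defs
begin

text \<open>The Lipschitz constant \<open>G\<close> near \<open>S\<close> forces every subgradient at a point of \<open>S\<close> to lie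
  within \<open>G\<close> of the normal cone of the domain: the difference is its projection onto the closed
  tangent cone, along which the directional growth of \<open>g\<close> is at most \<open>G\<close>. Hence the inexact
  stationarity condition says that \<open>\<beta>\<^sub>k \<parallel>A\<parallel>\<^bsup>\<nu>-1\<^esup> (- J\<^sup>T A)\<close> is within a bounded distance of the normal
  cone, and since this cone is invariant under scaling, the regularity assumption yields
  \<open>\<beta>\<^sub>k R \<parallel>A\<parallel>\<^sup>\<nu> \<le> const\<close>. Dual feasibility is witnessed by the multiplier
  \<open>y\<^sup>k + \<beta>\<^sub>k \<nabla>\<phi>(A(x\<^sup>k\<^sup>+\<^sup>1))\<close>, for which the residual is that of the subproblem.\<close>

section \<open>Gradients\<close>

lemma grad_eqI:
  assumes "GDERIV F x :> D"
  shows "grad F x = D"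
  unfolding grad_def
proof (rule the_equality)
  fix E assume "GDERIV F x :> E"
  then have "(\<lambda>h. h \<bullet> E) = (\<lambda>h. h \<bullet> D)"
    using assms unfolding gderiv_def by (rule has_derivative_unique)
  then have "h \<bullet> (E - D) = 0" for h
    by (simp add: inner_diff_right fun_eq_iff)
  then show "E = D"
    using inner_eq_zero_iff[of "E - D"] by simp
qed (fact assms)

lemma GDERIV_grad:
  fixes f :: "'a::euclidean_space \<Rightarrow> real"
  assumes "f differentiable (at x)"
  shows "GDERIV f x :> grad f x"
proof -
  obtain f' where f': "(f has_derivative f') (at x)"
    using assms by (auto simp: differentiable_def)
  have "linear f'"
    using f' by (rule has_derivative_linear)
  \<comment> \<open>\<open>adjoint f' 1\<close> is the Riesz representer of the derivative.\<close>
  then have "f' = (\<lambda>h. h \<bullet> adjoint f' 1)"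
    by (auto simp: adjoint_works)
  with f' have "GDERIV f x :> adjoint f' 1"
    by (simp add: gderiv_def)
  then show ?thesis
    by (simp add: grad_eqI)
qed

text \<open>Away from 0 this is the chain rule through the norm. At 0 the difference quotient is
  \<open>norm h powr \<nu> / (\<nu> + 1)\<close>, which vanishes in the limit since \<nu> > 0; the
  stated vector is then 0 because z is.\<close>

lemma GDERIV_pow_fun:
  fixes z :: "'a::real_inner"
  assumes "\<nu> > 0"
  shows "GDERIV (pow_fun \<nu>) z :> norm z powr (\<nu> - 1) *\<^sub>R z"
proof (cases "z = 0")
  case True
  have "((\<lambda>h::'a. norm h powr \<nu> / (\<nu> + 1)) \<longlongrightarrow> 0 powr \<nu> / (\<nu> + 1)) (at 0)"
    using assms by (intro tendsto_intros tendsto_powr' tendsto_norm_zero) auto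
  then have "((\<lambda>h::'a. norm h powr \<nu> / (\<nu> + 1)) \<longlongrightarrow> 0) (at 0)"
    using assms by simp
  then have "((\<lambda>h::'a. norm (pow_fun \<nu> h) / norm h) \<longlongrightarrow> 0) (at 0)"
  proof (rule Lim_transform_eventually)
    show "\<forall>\<^sub>F h::'a in at 0. norm h powr \<nu> / (\<nu> + 1) = norm (pow_fun \<nu> h) / norm h"
      using assms by (auto simp: eventually_at_filter pow_fun_def powr_add)
  qed
  then show ?thesis
    using True assms by (simp add: gderiv_def has_derivative_at pow_fun_def bounded_linear_zero)
next
  case False
  have "((\<lambda>t. 1 / (\<nu> + 1) * t powr (\<nu> + 1)) has_real_derivative norm z powr \<nu>) (at (norm z))"
    using False assms by (auto intro!: derivative_eq_intros)
  then have "GDERIV (\<lambda>w. 1 / (\<nu> + 1) * norm w powr (\<nu> + 1)) z :> norm z powr \<nu> *\<^sub>R sgn z"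
    by (rule GDERIV_DERIV_compose[OF GDERIV_norm[OF False]])
  then show ?thesis
    using False by (simp add: pow_fun_def[abs_def] sgn_div_norm powr_diff divide_inverse)
qed

section \<open>Chain rule and gradient of the augmented Lagrangian\<close>

lemma GDERIV_compose_Jac:
  fixes A :: "real^'n \<Rightarrow> real^'m"
  assumes "GDERIV F (A x) :> D" and "A differentiable (at x)"
  shows "GDERIV (\<lambda>z. F (A z)) x :> transpose (Jac A x) *v D"
proof -
  have "(A has_derivative (\<lambda>h. Jac A x *v h)) (at x)"
    using assms(2) by (simp add: Jac_def jacobian_works)
  then have "((\<lambda>z. F (A z)) has_derivative (\<lambda>h. (Jac A x *v h) \<bullet> D)) (at x)"
    using assms(1) unfolding gderiv_def by (rule has_derivative_compose)
  then show ?thesis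
    by (simp add: gderiv_def dot_lmul_matrix[symmetric] inner_commute)
qed

text \<open>Penalty and multiplier terms are merged into one shifted multiplier, so that the
  subproblem residual reads as a stationarity residual of the original problem.\<close>

lemma grad_psi:
  assumes "f differentiable (at x)" and "A differentiable (at x)" and "\<nu> > 0"
  shows "grad (\<lambda>z. psi f A \<nu> \<beta> z y) x =
    grad f x + transpose (Jac A x) *v (y + (\<beta> * norm (A x) powr (\<nu> - 1)) *\<^sub>R A x)"
proof -
  have y: "GDERIV (\<lambda>w. w \<bullet> y) (A x) :> y"
    by (simp add: gderiv_def bounded_linear_imp_has_derivative bounded_linear_inner_left)
  have p: "GDERIV (pow_fun \<nu>) (A x) :> norm (A x) powr (\<nu> - 1) *\<^sub>R A x"
    by (rule GDERIV_pow_fun) fact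
  have "((\<lambda>w. w \<bullet> y + \<beta> * pow_fun \<nu> w) has_derivative
      (\<lambda>h. h \<bullet> y + \<beta> * (h \<bullet> (norm (A x) powr (\<nu> - 1) *\<^sub>R A x)))) (at (A x))"
    using y p unfolding gderiv_def by (intro derivative_intros)
  then have "GDERIV (\<lambda>w. w \<bullet> y + \<beta> * pow_fun \<nu> w) (A x) :>
      y + (\<beta> * norm (A x) powr (\<nu> - 1)) *\<^sub>R A x"
    by (simp add: gderiv_def inner_add_right mult.assoc)
  from GDERIV_add[OF GDERIV_grad[OF assms(1)] GDERIV_compose_Jac[OF this assms(2)]]
  show ?thesis
    by (intro grad_eqI) (simp add: psi_def add.assoc)
qed

text \<open>With u = M^T y, |u|^2 = <y, M u>; Cauchy-Schwarz and the operator norm of M itself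
  suffice after cancelling |u|.\<close>

lemma norm_transpose_mult_le:
  fixes M :: "real^'n^'m"
  shows "norm (transpose M *v y) \<le> spec_norm M * norm y"
proof (cases "transpose M *v y = 0")
  case True
  then show ?thesis
    by (simp add: spec_norm_def onorm_pos_le matrix_vector_mul_bounded_linear)
next
  case False
  let ?u = "transpose M *v y"
  have "norm ?u * norm ?u = y \<bullet> (M *v ?u)"
    by (simp add: dot_square_norm[symmetric] dot_lmul_matrix[symmetric] power2_norm_eq_inner flip: power2_eq_square)
  also have "\<dots> \<le> norm y * norm (M *v ?u)"
    by (rule norm_cauchy_schwarz)
  also have "\<dots> \<le> norm y * (spec_norm M * norm ?u)"
    unfolding spec_norm_def
    by (intro mult_left_mono onorm matrix_vector_mul_bounded_linear) auto
  finally have "norm ?u * norm ?u \<le> (spec_norm M * norm y) * norm ?u"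
    by (simp add: mult_ac)
  with False show ?thesis
    by simp
qed

section \<open>Subgradients and the normal cone of the domain\<close>

text \<open>The infimum need not be attained, hence the slack d > e. The real bound also excludes an
  empty C, whose distance is infinite.\<close>

lemma ex_dist_less_if_set_dist_le:
  assumes "set_dist p C \<le> ereal e" and "e < d"
  shows "\<exists>q\<in>C. dist p q < d"
proof -
  have "(INF q\<in>C. ereal (dist p q)) < ereal d"
    using assms by (auto simp: set_dist_def intro: le_less_trans)
  then show ?thesis
    by (auto simp: INF_less_iff)
qed

lemma set_dist_le_dist: "q \<in> C \<Longrightarrow> set_dist p C \<le> ereal (dist p q)"
  unfolding set_dist_def by (rule INF_lower)

section \<open>Normal cone and effective domain\<close>

lemma normal_cone_scaleR:
  assumes "v \<in> normal_cone X x" and "c \<ge> 0"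
  shows "c *\<^sub>R v \<in> normal_cone X x"
  using assms by (auto simp: normal_cone_def mult_nonneg_nonpos split: if_splits)

lemma ereal_real_if_effdom: "proper g \<Longrightarrow> x \<in> effdom g \<Longrightarrow> ereal (real_of_ereal (g x)) = g x"
  by (cases "g x") (auto simp: proper_def effdom_def)

lemma convex_effdom:
  assumes "proper g" and "convex_ereal g"
  shows "convex (effdom g)"
proof (rule convexI)
  fix x y and u v :: real
  assume xy: "x \<in> effdom g" "y \<in> effdom g" and uv: "0 \<le> u" "0 \<le> v" "u + v = 1"
  show "u *\<^sub>R x + v *\<^sub>R y \<in> effdom g"
  \<comment> \<open>\<open>convex_ereal\<close> speaks only of weights strictly between 0 and 1; the
    endpoints are the given points.\<close>
  proof (cases "v \<in> {0<..<1}")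
    case True
    have u: "u = 1 - v"
      using uv by simp
    obtain a b where ab: "g x = ereal a" "g y = ereal b"
      using ereal_real_if_effdom[OF assms(1)] xy by metis
    have "g (u *\<^sub>R x + v *\<^sub>R y) \<le> ereal u * g x + ereal v * g y"
      using assms(2) True unfolding convex_ereal_def u by blast
    also have "\<dots> < \<infinity>"
      by (simp add: ab)
    finally show ?thesis
      by (simp add: effdom_def)
  next
    case False
    with uv have "v = 0 \<and> u = 1 \<or> v = 1 \<and> u = 0"
      by auto
    with xy show ?thesis
      by auto
  qed
qed

text \<open>Shrink the segment from x to z until its end w lies in the neighbourhood where G is
  valid. There the subgradient and Lipschitz inequalities combine, and dividing by the shrinking
  factor returns to z.\<close>

lemma subgradient_growth_le:
  fixes g :: "'a::real_inner \<Rightarrow> ereal"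
  assumes g: "proper g" "convex_ereal g" and x: "x \<in> S" "S \<subseteq> effdom g"
    and G: "G_constant_near g S G" and v: "v \<in> subdifferential g x" and z: "z \<in> effdom g"
  shows "v \<bullet> (z - x) \<le> G * norm (z - x)"
proof (cases "z = x")
  case False
  obtain U where U: "open U" "S \<subseteq> U" and GU: "G_constant g (U \<inter> effdom g) G"
    using G by (auto simp: G_constant_near_def)
  obtain r where r: "r > 0" "ball x r \<subseteq> U"
    using U x by (meson openE subsetD)
  \<comment> \<open>The factor 2 keeps w strictly inside the ball; the minimum with 1 keeps it on
    the segment, hence in the convex domain.\<close>
  define t where "t = min 1 (r / (2 * norm (z - x)))"
  define w where "w = (1 - t) *\<^sub>R x + t *\<^sub>R z"
  have t: "0 < t" "t \<le> 1"
    using r False by (auto simp: t_def)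
  have wx: "w - x = t *\<^sub>R (z - x)"
    by (simp add: w_def algebra_simps)
  have "t * norm (z - x) \<le> r / (2 * norm (z - x)) * norm (z - x)"
    by (intro mult_right_mono) (auto simp: t_def)
  also have "\<dots> < r"
    using r False by simp
  finally have "dist x w < r"
    using t by (simp add: dist_norm norm_minus_commute[of x] wx)
  then have "w \<in> U"
    using r by auto
  moreover have we: "w \<in> effdom g"
    unfolding w_def using convex_effdom[OF g] x z t by (intro convexD) auto
  ultimately have "\<bar>g w - g x\<bar> \<le> ereal (G * norm (w - x))"
    using GU x U by (auto simp: G_constant_def)
  moreover have "g x + ereal (v \<bullet> (w - x)) \<le> g w"
    using v by (simp add: subdifferential_def)
  moreover obtain a b where "g w = ereal a" "g x = ereal b"
    using g we x ereal_real_if_effdom by (metis subsetD)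
  ultimately have "v \<bullet> (w - x) \<le> G * norm (w - x)"
    by auto
  then have "t * (v \<bullet> (z - x)) \<le> t * (G * norm (z - x))"
    using t by (simp add: wx mult_ac)
  with t show ?thesis
    by simp
qed simp

text \<open>Moreau decomposition: v - t is normal and orthogonal to the tangential part t, so |t|^2
  = <v, t> \<le> G |t|.\<close>

lemma subgradient_near_normal_cone:
  fixes g :: "'a::euclidean_space \<Rightarrow> ereal"
  assumes g: "proper g" "convex_ereal g" and x: "x \<in> S" "S \<subseteq> effdom g"
    and G: "G_constant_near g S G" and v: "v \<in> subdifferential g x"
  shows "\<exists>p\<in>normal_cone (effdom g) x. norm (v - p) \<le> G"
proof -
  define C where "C = cone hull ((\<lambda>z. z - x) ` effdom g)"
  define t where "t = closest_point (closure C) v"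
  have xd: "x \<in> effdom g"
    using x by auto
  have conv: "convex (closure C)"
    unfolding C_def using convex_effdom[OF g]
    by (intro convex_closure convex_cone_hull) (auto intro: convex_translation_subtract)
  have CI: "z - x \<in> closure C" if "z \<in> effdom g" for z
    using that unfolding C_def by (meson closure_subset hull_subset image_eqI subsetD)
  have cone: "cone (closure C)"
    unfolding C_def by (intro cone_closure cone_cone_hull)
  have t: "t \<in> closure C"
    unfolding t_def using CI xd by (intro closest_point_in_set) auto
  have proj: "(v - t) \<bullet> (w - t) \<le> 0" if "w \<in> closure C" for w
    unfolding t_def using conv that by (intro closest_point_dot) auto
  \<comment> \<open>Testing the projection inequality with 0 and with 2t gives both signs of <v - t,
    t>.\<close>
  have "0 *\<^sub>R t \<in> closure C" "2 *\<^sub>R t \<in> closure C"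
    using cone t by (auto simp del: scale_zero_left intro: mem_cone)
  from proj[OF this(1)] proj[OF this(2)] have orth: "(v - t) \<bullet> t = 0"
    by (simp add: inner_diff_right)
  have "(v - t) \<bullet> (z - x) \<le> 0" if "z \<in> effdom g" for z
    using proj[OF CI[OF that]] orth by (simp add: inner_diff_right)
  then have "v - t \<in> normal_cone (effdom g) x"
    using xd by (auto simp: normal_cone_def)
  moreover have "v \<bullet> t \<le> G * norm t"
  proof -
    \<comment> \<open>The growth bound is positively homogeneous, so it extends from differences z -
      x to the cone, and being a closed condition also to its closure.\<close>
    have "C \<subseteq> {w. v \<bullet> w \<le> G * norm w}"
    proof
      fix w assume "w \<in> C"
      then obtain c z where cz: "c \<ge> 0" "z \<in> effdom g" "w = c *\<^sub>R (z - x)"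
        unfolding C_def cone_hull_expl by auto
      from mult_left_mono[OF subgradient_growth_le[OF g x G v cz(2)] cz(1)]
      show "w \<in> {w. v \<bullet> w \<le> G * norm w}"
        using cz by (simp add: mult_ac)
    qed
    moreover have "closed {w. v \<bullet> w \<le> G * norm w}"
      by (intro closed_Collect_le continuous_intros)
    ultimately show ?thesis
      using t closure_minimal by blast
  qed
  then have "norm t * norm t \<le> G * norm t"
    using orth by (simp add: inner_diff_left power2_norm_eq_inner flip: power2_eq_square)
  then have "norm t \<le> G"
    using G by (cases "t = 0") (auto simp: G_constant_near_def G_constant_def)
  ultimately show ?thesis
    by (intro bexI[of _ "v - t"]) auto
qed

section \<open>From Lipschitz constants on compact sets to constants near them\<close>

text \<open>If no constant worked near \<open>S\<close>, violating pairs for the constants \<open>n = 0, 1, \<dots>\<close> at distance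
  less than \<open>1/(n+1)\<close> from \<open>S\<close> would form, together with \<open>S\<close>, a compact subset of the domain on
  which \<open>g\<close> is not Lipschitz. This works even if the domain is not locally compact.\<close>

lemma ex_G_constant_near:
  fixes g :: "'a::euclidean_space \<Rightarrow> ereal"
  assumes G: "\<And>K. K \<noteq> {} \<Longrightarrow> compact K \<Longrightarrow> K \<subseteq> effdom g \<Longrightarrow> \<exists>G. G_constant g K G"
    and S: "S \<noteq> {}" "compact S" "S \<subseteq> effdom g"
  shows "\<exists>G. G_constant_near g S G"
proof (rule ccontr)
  assume no: "\<nexists>G. G_constant_near g S G"
  define U where "U n = {z. infdist z S < 1 / real (Suc n)}" for n
  have "\<exists>p q. p \<in> U n \<inter> effdom g \<and> q \<in> U n \<inter> effdom g \<and>
      \<not> \<bar>g q - g p\<bar> \<le> ereal (real n * norm (q - p))" for n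
  proof -
    have "open (U n)"
      unfolding U_def by (intro open_Collect_less continuous_intros)
    moreover have "S \<subseteq> U n"
      by (auto simp: U_def)
    ultimately have "\<not> G_constant g (U n \<inter> effdom g) (real n)"
      using no unfolding G_constant_near_def by blast
    then show ?thesis
      by (auto simp: G_constant_def)
  qed
  then obtain p q where pU: "\<And>n. p n \<in> U n \<inter> effdom g" and qU: "\<And>n. q n \<in> U n \<inter> effdom g"
    and pq: "\<And>n. \<not> \<bar>g (q n) - g (p n)\<bar> \<le> ereal (real n * norm (q n - p n))"
    by metis
  define K where "K = S \<union> range p \<union> range q"
  \<comment> \<open>K is written as an intersection of compact sets: a closed neighbourhood of S
    plus the finitely many earlier points that may lie outside it.\<close>
  define N where "N n = {z. infdist z S \<le> 1 / real (Suc n)} \<union> (p ` {..<n} \<union> q ` {..<n})" for n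
  have "K = (\<Inter>n. N n)"
  proof (intro set_eqI iffI INT_I)
    fix z n assume "z \<in> K"
    then consider "z \<in> S" | m where "z = p m \<or> z = q m"
      by (auto simp: K_def)
    then show "z \<in> N n"
    proof cases
      case 2
      show ?thesis
      proof (cases "m < n")
        case False
        have "infdist z S < 1 / real (Suc m)"
          using 2 pU[of m] qU[of m] by (auto simp: U_def)
        also have "\<dots> \<le> 1 / real (Suc n)"
          using False by (simp add: field_simps)
        finally show ?thesis
          by (simp add: N_def)
      qed (use 2 in \<open>auto simp: N_def\<close>)
    qed (simp add: N_def)
  next
    fix z assume z: "z \<in> (\<Inter>n. N n)"
    show "z \<in> K"
    proof (rule ccontr)
      assume "z \<notin> K"
      with z have le: "infdist z S \<le> 1 / real (Suc n)" for n
        by (auto simp: N_def K_def)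
      have "infdist z S \<le> 0"
      proof (rule ccontr)
        assume "\<not> infdist z S \<le> 0"
        then obtain n where "1 / real (Suc n) < infdist z S"
          using nat_approx_posE[of "infdist z S"] by auto
        with le[of n] show False
          by simp
      qed
      then have "z \<in> S"
        using S infdist_nonneg[of z S]
        by (simp add: in_closed_iff_infdist_zero compact_imp_closed)
      with \<open>z \<notin> K\<close> show False
        by (simp add: K_def)
    qed
  qed
  moreover have "\<And>n. compact (N n)"
  proof -
    fix n
    have "compact {z. infdist z S \<le> 1 / real (Suc n)}"
      using S by (intro compact_infdist_le) auto
    then show "compact (N n)"
      unfolding N_def by (intro compact_Un finite_imp_compact[of "_ ` _"]) auto
  qed
  ultimately have "compact K"
    by (auto intro: compact_Inter)
  moreover have "K \<noteq> {}" "K \<subseteq> effdom g"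
    using S pU qU by (auto simp: K_def)
  ultimately obtain G where "G_constant g K G"
    using G by blast
  then have le: "\<bar>g (q n) - g (p n)\<bar> \<le> ereal (G * norm (q n - p n))" for n
    by (auto simp: G_constant_def K_def)
  obtain n :: nat where "G \<le> real n"
    using real_arch_simple by blast
  then have "ereal (G * norm (q n - p n)) \<le> ereal (real n * norm (q n - p n))"
    by (auto intro: mult_right_mono)
  with le[of n] pq[of n] show False
    by (meson order_trans)
qed

section \<open>The complexity bound\<close>

text \<open>Replacing the subgradient by a nearby normal vector leaves
  \<open>c *\<^sub>R (- (J' *v A x))\<close> as the only term not bounded a priori;
  \<open>R_constant\<close> bounds its distance to the normal cone from below.\<close>

lemma feasibility_bound:
  fixes f :: "real^'n \<Rightarrow> real" and A :: "real^'n \<Rightarrow> real^'m"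
  assumes g: "proper g" "convex_ereal g" and x: "x \<in> S" "S \<subseteq> effdom g"
    and G: "G_constant_near g S G" and R: "R_constant g A S R"
    and F: "norm (grad f x) \<le> Fmax" and J: "spec_norm (Jac A x) \<le> Jmax" and y: "norm y \<le> ymax"
    and \<beta>: "\<beta> > 0"
    and d: "set_dist (- (grad f x + transpose (Jac A x) *v
        (y + (\<beta> * norm (A x) powr (\<nu> - 1)) *\<^sub>R A x))) (subdifferential g x) \<le> ereal e"
  shows "\<beta> * R * norm (A x) powr \<nu> \<le> Fmax + G + Jmax * ymax + e"
proof (rule field_le_epsilon)
  \<comment> \<open>\<delta> pays for a nearest subgradient that may not be attained.\<close>
  fix \<delta> :: real assume "\<delta> > 0"
  define J' where "J' = transpose (Jac A x)"
  define c where "c = \<beta> * norm (A x) powr (\<nu> - 1)"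
  obtain v where v: "v \<in> subdifferential g x"
    and dv: "dist (- (grad f x + J' *v (y + c *\<^sub>R A x))) v < e + \<delta>"
    using ex_dist_less_if_set_dist_le[OF d] \<open>\<delta> > 0\<close> unfolding J'_def c_def
    by (metis less_add_same_cancel1)
  obtain p where p: "p \<in> normal_cone (effdom g) x" and pv: "norm (v - p) \<le> G"
    using subgradient_near_normal_cone[OF g x G v] by blast
  have Jy: "norm (J' *v y) \<le> Jmax * ymax"
  proof -
    have "norm (J' *v y) \<le> spec_norm (Jac A x) * norm y"
      unfolding J'_def by (rule norm_transpose_mult_le)
    also have "\<dots> \<le> Jmax * ymax"
    proof (rule mult_mono[OF J y])
      have "0 \<le> spec_norm (Jac A x)"
        by (simp add: spec_norm_def onorm_pos_le matrix_vector_mul_bounded_linear)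
      with J show "0 \<le> Jmax" by linarith
    qed simp
    finally show ?thesis .
  qed
  define r where "r = - (grad f x + J' *v (y + c *\<^sub>R A x)) - v"
  have r: "norm r < e + \<delta>"
    using dv by (simp add: r_def dist_norm)
  have eq: "c *\<^sub>R (- (J' *v A x)) - p = grad f x + J' *v y + r + (v - p)"
    by (simp add: r_def matrix_vector_right_distrib matrix_vector_mult_scaleR)
  have "norm (c *\<^sub>R (- (J' *v A x)) - p) \<le> norm (grad f x) + norm (J' *v y) + norm r + norm (v - p)"
    unfolding eq by (intro order_trans[OF norm_triangle_ineq] add_mono order_refl)
  then have up: "norm (c *\<^sub>R (- (J' *v A x)) - p) \<le> Fmax + G + Jmax * ymax + e + \<delta>"
    using F Jy r pv by linarith
  show "\<beta> * R * norm (A x) powr \<nu> \<le> Fmax + G + Jmax * ymax + e + \<delta>"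
  proof (cases "A x = 0")
    case True
    have "0 \<le> norm (c *\<^sub>R (- (J' *v A x)) - p)"
      by simp
    with up have "0 \<le> Fmax + G + Jmax * ymax + e + \<delta>"
      by (rule order_trans[rotated])
    with True show ?thesis
      by simp
  next
    case False
    then have c: "c > 0"
      using \<beta> by (simp add: c_def)
    have "ereal (R * norm (A x)) \<le> set_dist (- (J' *v A x)) (normal_cone (effdom g) x)"
      using R x by (auto simp: R_constant_def J'_def)
    \<comment> \<open>As a cone, the normal cone contains p / c; multiplying by c afterwards
      recovers the difference estimated in \<open>up\<close>.\<close>
    also have "\<dots> \<le> ereal (dist (- (J' *v A x)) ((1 / c) *\<^sub>R p))"
      using p c by (intro set_dist_le_dist normal_cone_scaleR) auto
    finally have "c * (R * norm (A x)) \<le> c * norm (- (J' *v A x) - (1 / c) *\<^sub>R p)"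
      using c by (simp add: dist_norm)
    also have "\<dots> = norm (c *\<^sub>R (- (J' *v A x) - (1 / c) *\<^sub>R p))"
      using c by simp
    also have "c *\<^sub>R (- (J' *v A x) - (1 / c) *\<^sub>R p) = c *\<^sub>R (- (J' *v A x)) - p"
      using c by (simp add: scaleR_diff_right)
    also note up
    also have "c * (R * norm (A x)) = \<beta> * R * norm (A x) powr \<nu>"
      using False by (simp add: c_def powr_diff)
    finally show ?thesis .
  qed
qed

text \<open>The existence conjunct ensures that the bound, quantified over all G valid near S, is
  not vacuous.\<close>

theorem theorem1:
  fixes f :: "real^'n \<Rightarrow> real" and g :: "real^'n \<Rightarrow> ereal" and A :: "real^'n \<Rightarrow> real^'m"
    and S :: "(real^'n) set"
    and x :: "nat \<Rightarrow> real^'n" and y :: "nat \<Rightarrow> real^'m"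
    and \<sigma> \<beta> \<epsilon> :: "nat \<Rightarrow> real"
    and \<nu> lam \<omega> H\<^sub>f H\<^sub>A Amax Jmax Fmax \<nu>\<^sub>f \<nu>\<^sub>A R ymax :: real
  assumes "C1_fun f" and "C1_map A"
    and "assumption_S f g A" and "assumption_G g" and "assumption_LC f g" and "assumption_R g A"
    and "inexact_power_ALM f g A \<nu> lam \<omega> \<sigma> \<beta> \<epsilon> x y"
    and "\<epsilon> 1 \<ge> \<epsilon> 2"
    and "S \<noteq> {}" and "compact S" and "S \<subseteq> effdom g" and "\<forall>k\<ge>1. x k \<in> S"
    and "S_constants f A S H\<^sub>f H\<^sub>A Amax Jmax Fmax \<nu>\<^sub>f \<nu>\<^sub>A"
    and "R_constant g A S R"
    and "\<forall>k\<ge>1. norm (y k) \<le> ymax"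
  shows "(\<exists>G. G_constant_near g S G) \<and>
    (\<forall>G. G_constant_near g S G \<longrightarrow>
      (let Qf = lam + Jmax * \<sigma> 1 * ((Fmax + G + Jmax * ymax + \<epsilon> 1) / R);
           QA = ((Fmax + G + Jmax * ymax + \<epsilon> 1) / R) powr (1 / \<nu>)
       in \<forall>k\<ge>1. stationary_point f g A
            (Qf / (\<beta> 1 * \<omega> ^ (k - 1)))
            (QA / (\<beta> 1 powr (1 / \<nu>) * \<omega> powr (real (k - 1) / \<nu>)))
            (x (k + 1))))"
proof (intro conjI allI impI)
  show "\<exists>G. G_constant_near g S G"
    using assms by (intro ex_G_constant_near) (auto simp: assumption_G_def)
next
  fix G assume G: "G_constant_near g S G"
  define M where "M = Fmax + G + Jmax * ymax + \<epsilon> 1"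
  have g: "proper g" "convex_ereal g"
    using assms(4) by (auto simp: assumption_G_def)
  have alg: "0 < \<nu>" "lam > 0" "\<omega> > 1" "\<sigma> 1 > 0" "\<beta> 1 > 0"
    and \<beta>_Suc: "\<And>k. k \<ge> 1 \<Longrightarrow> \<beta> (k + 1) = \<omega> * \<beta> k"
    and \<epsilon>_Suc: "\<And>k. k \<ge> 1 \<Longrightarrow> \<epsilon> (k + 1) = lam / \<beta> k"
    and sub: "\<And>k. k \<ge> 1 \<Longrightarrow> set_dist (- grad (\<lambda>z. psi f A \<nu> (\<beta> k) z (y k)) (x (k + 1)))
        (subdifferential g (x (k + 1))) \<le> ereal (\<epsilon> (k + 1))"
    using assms(7) unfolding inexact_power_ALM_def by blast+
  have pos: "Jmax > 0" "Fmax > 0" "R > 0" "G \<ge> 0"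
    using assms(13,14) G
    by (auto simp: S_constants_def R_constant_def G_constant_near_def G_constant_def)
  have bounds: "norm (grad f z) \<le> Fmax" "spec_norm (Jac A z) \<le> Jmax" if "z \<in> S" for z
    using assms(13) that by (auto simp: S_constants_def)
  have "0 \<le> norm (y 1)" "norm (y 1) \<le> ymax"
    using assms(15) by auto
  then have "ymax \<ge> 0"
    by linarith
  have \<epsilon>2: "\<epsilon> 2 = lam / \<beta> 1"
    using \<epsilon>_Suc[of 1] by (simp add: numeral_2_eq_2)
  then have "\<epsilon> 1 > 0"
    using assms(8) alg by (smt (verit) divide_pos_pos)
  then have M: "M > 0"
    using pos \<open>ymax \<ge> 0\<close> by (simp add: M_def add_pos_nonneg add_nonneg_pos)
  have \<beta>_eq: "\<beta> k = \<beta> 1 * \<omega> ^ (k - 1)" if "k \<ge> 1" for k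
    using that
  proof (induction k rule: dec_induct)
    case (step k)
    then show ?case
      using \<beta>_Suc[of k] by (cases k) auto
  qed simp
  have "stationary_point f g A ((lam + Jmax * \<sigma> 1 * (M / R)) / (\<beta> 1 * \<omega> ^ (k - 1)))
      ((M / R) powr (1 / \<nu>) / (\<beta> 1 powr (1 / \<nu>) * \<omega> powr (real (k - 1) / \<nu>))) (x (k + 1))"
    if k: "k \<ge> 1" for k
  proof -
    let ?x = "x (k + 1)"
    \<comment> \<open>The dual witness takes its step with the penalty \<open>\<beta> k\<close>,
      whereas \<open>y (k + 1)\<close> takes it with \<open>\<sigma> (k + 1)\<close>.\<close>
    define u where "u = y k + (\<beta> k * norm (A ?x) powr (\<nu> - 1)) *\<^sub>R A ?x"
    have xS: "?x \<in> S"
      using assms(12) by simp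
    have \<beta>: "\<beta> k \<ge> \<beta> 1" "\<beta> k > 0"
      using \<beta>_eq[OF k] alg by simp_all
    have grad: "grad (\<lambda>z. psi f A \<nu> (\<beta> k) z (y k)) ?x = grad f ?x + transpose (Jac A ?x) *v u"
      unfolding u_def using assms(1,2) alg by (intro grad_psi) (auto simp: C1_fun_def C1_map_def)
    have sub': "set_dist (- (grad f ?x + transpose (Jac A ?x) *v u)) (subdifferential g ?x)
        \<le> ereal (lam / \<beta> k)"
      using sub[OF k] by (simp only: grad \<epsilon>_Suc[OF k])
    have "\<beta> k * R * norm (A ?x) powr \<nu> \<le> Fmax + G + Jmax * ymax + lam / \<beta> k"
      using assms(15) k
      by (intro feasibility_bound[OF g xS assms(11) G assms(14) bounds[OF xS] _ \<beta>(2)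
            sub'[unfolded u_def]]) auto
    \<comment> \<open>Since \<beta> never falls below \<open>\<beta> 1\<close>, lam /
      \<open>\<beta> k\<close> \<le> \<open>\<epsilon> 2\<close> \<le> \<open>\<epsilon> 1\<close>,
      which makes the constant independent of k.\<close>
    also have "\<dots> \<le> M"
    proof -
      have "lam / \<beta> k \<le> lam / \<beta> 1"
        using \<beta> alg by (intro divide_left_mono) auto
      then show ?thesis
        using assms(8) \<epsilon>2 by (simp add: M_def)
    qed
    finally have "norm (A ?x) powr \<nu> \<le> M / R / \<beta> k"
      using \<beta> pos by (simp add: field_simps)
    then have "(norm (A ?x) powr \<nu>) powr (1 / \<nu>) \<le> (M / R / \<beta> k) powr (1 / \<nu>)"
      using alg by (intro powr_mono2) auto
    also have "(norm (A ?x) powr \<nu>) powr (1 / \<nu>) = norm (A ?x)"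
      using alg by (simp add: powr_powr)
    also have "(M / R / \<beta> k) powr (1 / \<nu>) = (M / R) powr (1 / \<nu>) / \<beta> k powr (1 / \<nu>)"
      by (rule powr_divide)
    also have "\<beta> k powr (1 / \<nu>) = \<beta> 1 powr (1 / \<nu>) * \<omega> powr (real (k - 1) / \<nu>)"
    proof -
      have "\<omega> ^ (k - 1) = \<omega> powr real (k - 1)"
        using alg by (simp add: powr_realpow)
      then show ?thesis
        unfolding \<beta>_eq[OF k] powr_mult by (simp only: powr_powr) simp
    qed
    finally have feas: "norm (A ?x) \<le>
      (M / R) powr (1 / \<nu>) / (\<beta> 1 powr (1 / \<nu>) * \<omega> powr (real (k - 1) / \<nu>))" .
    \<comment> \<open>The subproblem tolerance already gives lam in the numerator; the term added in
      Qf is nonnegative because M > 0.\<close>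
    have "lam / \<beta> k \<le> (lam + Jmax * \<sigma> 1 * (M / R)) / (\<beta> 1 * \<omega> ^ (k - 1))"
      unfolding \<beta>_eq[OF k, symmetric] using alg pos M \<beta> by (intro divide_right_mono) auto
    then have "set_dist (- grad f ?x - transpose (Jac A ?x) *v u) (subdifferential g ?x)
        \<le> ereal ((lam + Jmax * \<sigma> 1 * (M / R)) / (\<beta> 1 * \<omega> ^ (k - 1)))"
      using sub' by (simp add: order_trans)
    with feas show ?thesis
      unfolding stationary_point_def by blast
  qed
  then show "let Qf = lam + Jmax * \<sigma> 1 * ((Fmax + G + Jmax * ymax + \<epsilon> 1) / R);
           QA = ((Fmax + G + Jmax * ymax + \<epsilon> 1) / R) powr (1 / \<nu>)
       in \<forall>k\<ge>1. stationary_point f g A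
            (Qf / (\<beta> 1 * \<omega> ^ (k - 1)))
            (QA / (\<beta> 1 powr (1 / \<nu>) * \<omega> powr (real (k - 1) / \<nu>)))
            (x (k + 1))"
    by (simp add: M_def Let_def)
qed

end
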